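(* Let $\mathbf k$ be a field of characteristic $0$. The complexes $\mathcal E^\bullet_{0,1}$ and $\mathcal E^\bullet_{1,0}$ are acyclic; moreover, for $\epsilon\in\{0,1\}$, $H^{p}(\mathcal E^\bullet_{\epsilon,\epsilon})$ is zero for any $p\ne0$ and is $\mathbf k$ for $p=0$.
   Context: For $p\ge0$, $\mathcal A(x_1,\dots,x_p)$ is the free associative unital $\mathbf k$-algebra on $x_1,\dots,x_p$; $\mathcal A(x_1,\dots,x_p)_{[1,p]}$ is its part multilinear in $x_1,\dots,x_p$ (degree exactly one in each variable), on which $\mathfrak S_p$ acts by permuting variables; the superscript $\mathfrak S_p^-$ denotes the totally antisymmetric part. For $\epsilon,\epsilon'\in\{0,1\}$ set $\mathcal E^p_{\epsilon,\epsilon'}=\mathcal A(x_1,\dots,x_p)_{[1,p]}^{\mathfrak S_p^-}$ for $p\ge0$ (so $\mathcal E^0_{\epsilon,\epsilon'}=\mathbf k$), with differential $d^{p,p+1}_{\epsilon,\epsilon'}:\mathcal E^p_{\epsilon,\epsilon'}\to\mathcal E^{p+1}_{\epsilon,\epsilon'}$, $$(d^{p,p+1}_{\epsilon,\epsilon'}E)(x_1,\dots,x_{p+1})=\sum_{1\le i<j\le p+1}(-1)^{i+j+1}E([x_i,x_j],x_1,\dots\check x_i\dots\check x_j\dots,x_{p+1})$$ $$+\epsilon\sum_{i=1}^{p+1}(-1)^ix_iE(x_1,\dots\check x_i\dots,x_{p+1})+\epsilon'\sum_{i=1}^{p+1}(-1)^{i+1}E(x_1,\dots\check x_i\dots,x_{p+1})x_i,$$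 where $[a,b]=ab-ba$, $\check x_i$ means that $x_i$ is omitted, and the first sum is zero for $p=0$. This is a complex. *)

theory Defs
  imports "HOL-Library.Poly_Mapping" "HOL-Combinatorics.Permutations"
begin

section \<open>Free associative unital algebras\<close>

text \<open>
  The free monoid, written additively: on the finitely supported functions
  \<open>'a \<Rightarrow>\<^sub>0 'k\<close>, \<^theory>\<open>HOL-Library.Poly_Mapping\<close> provides the convolution product for an additive
  monoid \<open>'a\<close>. So \<open>('v, 'k) free_algebra\<close> is the monoid algebra of the free monoid on \<open>'v\<close>.
\<close>

datatype 'v free_word = Word (letters: "'v list")

instantiation free_word :: (type) monoid_add
begin

definition zero_free_word :: "'a free_word"
  where "0 = Word []"

definition plus_free_word :: "'a free_word \<Rightarrow> 'a free_word \<Rightarrow> 'a free_word"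
  where "u + v = Word (letters u @ letters v)"

instance
  by standard (simp_all add: zero_free_word_def plus_free_word_def)

end

type_synonym ('v, 'k) free_algebra = "'v free_word \<Rightarrow>\<^sub>0 'k"

definition gen :: "'v \<Rightarrow> ('v, 'k::field) free_algebra"
  where "gen v = Poly_Mapping.single (Word [v]) 1"

definition scale :: "'k::field \<Rightarrow> ('v, 'k) free_algebra \<Rightarrow> ('v, 'k) free_algebra"
  where "scale c E = Poly_Mapping.single 0 c * E"

definition commutator :: "'r::ring \<Rightarrow> 'r \<Rightarrow> 'r"
  where "commutator a b = a * b - b * a"

text \<open>The algebra homomorphism that sends each generator \<open>gen v\<close> to \<open>f v\<close>.\<close>

definition subst :: "('v \<Rightarrow> ('w, 'k::field) free_algebra) \<Rightarrow> ('v, 'k) free_algebra \<Rightarrow> ('w, 'k) free_algebra"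
  where "subst f E =
    (\<Sum>w\<in>Poly_Mapping.keys E. scale (Poly_Mapping.lookup E w) (prod_list (map f (letters w))))"

section \<open>The complexes\<close>

text \<open>
  All algebras \<open>\<A>(x\<^sub>1, \<dots>, x\<^sub>p)\<close> are taken inside the free algebra on the generators \<open>gen i\<close>,
  \<open>i :: nat\<close>, with \<open>x\<^sub>i = gen i\<close> for \<open>1 \<le> i \<le> p\<close>.
\<close>

type_synonym 'k ncpoly = "(nat, 'k) free_algebra"

definition free_alg :: "nat \<Rightarrow> 'k::field ncpoly set"
  where "free_alg p = {E. \<forall>w\<in>Poly_Mapping.keys E. set (letters w) \<subseteq> {1..p}}"

definition multilinear_part :: "nat \<Rightarrow> 'k::field ncpoly set"
  where "multilinear_part p =
    {E \<in> free_alg p. \<forall>w\<in>Poly_Mapping.keys E. \<forall>i\<in>{1..p}. count_list (letters w) i = 1}"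

definition cochains :: "nat \<Rightarrow> 'k::field ncpoly set"
  where "cochains p =
    {E \<in> multilinear_part p. \<forall>\<sigma>. \<sigma> permutes {1..p} \<longrightarrow> subst (\<lambda>i. gen (\<sigma> i)) E = of_int (sign \<sigma>) * E}"

text \<open>\<open>eval_at E [a\<^sub>1, \<dots>, a\<^sub>p]\<close> is \<open>E(a\<^sub>1, \<dots>, a\<^sub>p)\<close>; the shift is due to list positions starting at \<open>0\<close>.\<close>

definition eval_at :: "'k::field ncpoly \<Rightarrow> 'k ncpoly list \<Rightarrow> 'k ncpoly"
  where "eval_at E as = subst (\<lambda>i. as ! (i - 1)) E"

text \<open>\<open>vars_without n S\<close> is the list \<open>x\<^sub>1, \<dots>, x\<^sub>n\<close> with the \<open>x\<^sub>i\<close> for \<open>i \<in> S\<close> omitted.\<close>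

definition vars_without :: "nat \<Rightarrow> nat set \<Rightarrow> 'k::field ncpoly list"
  where "vars_without n S = map gen (filter (\<lambda>m. m \<notin> S) [1..<Suc n])"

definition diff :: "'k::field \<Rightarrow> 'k \<Rightarrow> nat \<Rightarrow> 'k ncpoly \<Rightarrow> 'k ncpoly"
  where "diff \<epsilon> \<epsilon>' p E =
      (\<Sum>(i, j) \<in> {(i, j). 1 \<le> i \<and> i < j \<and> j \<le> p + 1}.
         (-1) ^ (i + j + 1) * eval_at E (commutator (gen i) (gen j) # vars_without (p + 1) {i, j}))
    + scale \<epsilon> (\<Sum>i = 1..p + 1. (-1) ^ i * (gen i * eval_at E (vars_without (p + 1) {i})))
    + scale \<epsilon>' (\<Sum>i = 1..p + 1. (-1) ^ (i + 1) * (eval_at E (vars_without (p + 1) {i}) * gen i))"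

section \<open>Cohomology\<close>

definition cocycles :: "'k::field \<Rightarrow> 'k \<Rightarrow> nat \<Rightarrow> 'k ncpoly set"
  where "cocycles \<epsilon> \<epsilon>' p = {E \<in> cochains p. diff \<epsilon> \<epsilon>' p E = 0}"

definition coboundaries :: "'k::field \<Rightarrow> 'k \<Rightarrow> nat \<Rightarrow> 'k ncpoly set"
  where "coboundaries \<epsilon> \<epsilon>' p = (case p of 0 \<Rightarrow> {0} | Suc q \<Rightarrow> diff \<epsilon> \<epsilon>' q ` cochains q)"

text \<open>
  The underlying set of \<open>H\<^sup>p\<close>: the cosets of the coboundaries in the cocycles. The vector space
  operations on cosets are \<open>class_add\<close> and \<open>class_scale\<close>; the summand in \<open>class_scale\<close> makes
  the product with the scalar \<open>0\<close> the zero class \<open>coboundaries \<epsilon> \<epsilon>' p\<close> and not \<open>{0}\<close>.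
\<close>

definition cohomology :: "'k::field \<Rightarrow> 'k \<Rightarrow> nat \<Rightarrow> 'k ncpoly set set"
  where "cohomology \<epsilon> \<epsilon>' p =
    cocycles \<epsilon> \<epsilon>' p //
      {(E, F). E \<in> cocycles \<epsilon> \<epsilon>' p \<and> F \<in> cocycles \<epsilon> \<epsilon>' p \<and> E - F \<in> coboundaries \<epsilon> \<epsilon>' p}"

definition class_add :: "'k::field ncpoly set \<Rightarrow> 'k ncpoly set \<Rightarrow> 'k ncpoly set"
  where "class_add X Y = {E + F | E F. E \<in> X \<and> F \<in> Y}"

definition class_scale :: "'k::field \<Rightarrow> 'k \<Rightarrow> nat \<Rightarrow> 'k \<Rightarrow> 'k ncpoly set \<Rightarrow> 'k ncpoly set"
  where "class_scale \<epsilon> \<epsilon>' p c X = {scale c E + B | E B. E \<in> X \<and> B \<in> coboundaries \<epsilon> \<epsilon>' p}"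

definition cohomology_zero :: "'k::field \<Rightarrow> 'k \<Rightarrow> nat \<Rightarrow> bool"
  where "cohomology_zero \<epsilon> \<epsilon>' p \<longleftrightarrow> cohomology \<epsilon> \<epsilon>' p = {coboundaries \<epsilon> \<epsilon>' p}"

definition acyclic_complex :: "'k::field \<Rightarrow> 'k \<Rightarrow> bool"
  where "acyclic_complex \<epsilon> \<epsilon>' \<longleftrightarrow> (\<forall>p. cohomology_zero \<epsilon> \<epsilon>' p)"

text \<open>\<open>H\<^sup>p\<close> and the ground field are isomorphic as vector spaces.\<close>

definition cohomology_is_ground_field :: "'k::field \<Rightarrow> 'k \<Rightarrow> nat \<Rightarrow> bool"
  where "cohomology_is_ground_field \<epsilon> \<epsilon>' p \<longleftrightarrow>
    (\<exists>\<phi> :: 'k \<Rightarrow> 'k ncpoly set.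
       bij_betw \<phi> UNIV (cohomology \<epsilon> \<epsilon>' p) \<and>
       (\<forall>a b. \<phi> (a + b) = class_add (\<phi> a) (\<phi> b)) \<and>
       (\<forall>c a. \<phi> (c * a) = class_scale \<epsilon> \<epsilon>' p c (\<phi> a)))"

end

theory Submission
  imports Defs "HOL-Combinatorics.Multiset_Permutations"
begin

text \<open>
  Each cochain space is a line, spanned by the standard polynomial
  \<open>s\<^sub>p = \<Sum>\<^sub>\<sigma> sgn(\<sigma>) x\<^sub>\<sigma>\<^sub>(\<^sub>1\<^sub>) \<dots> x\<^sub>\<sigma>\<^sub>(\<^sub>p\<^sub>)\<close>, because the symmetric group acts simply transitively
  on the multilinear words. Hence the differential is multiplication by a scalar \<open>c\<^sub>p\<close>, namely
  \<open>c\<^sub>p = [p odd] - \<epsilon> + (-1)\<^sup>p \<epsilon>'\<close>: the last two summands come from expanding \<open>s\<^sub>p\<^sub>+\<^sub>1\<close> by the first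
  and by the last letter of each word, and the commutator part gives
  \<open>\<Sum>\<^sub>k (-1)\<^sup>k s\<^sub>p\<^sub>+\<^sub>1\<close> over the \<open>p\<close> positions \<open>k < p\<close> of the commutator. In each case the numbers
  \<open>c\<^sub>p\<close> alternate between zero and nonzero values.
\<close>

section \<open>The sign of a list\<close>

text \<open>This is \<open>(-1)\<close> to the number of inversions. It is defined on words, not on
  permutations, so that words on a set such as \<open>{1..n} - {i}\<close> have a sign without being
  renumbered.\<close>

fun list_sign :: "'a::linorder list \<Rightarrow> int" where
  "list_sign [] = 1"
| "list_sign (x # xs) = (-1) ^ card {y \<in> set xs. y < x} * list_sign xs"

lemma card_less_insert:
  fixes x :: "'a::linorder"
  assumes "finite S" "x \<notin> S"
  shows "card {y \<in> insert x S. y < z} = card {y \<in> S. y < z} + (if x < z then 1 else 0)"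
proof (cases "x < z")
  case True
  then have "{y \<in> insert x S. y < z} = insert x {y \<in> S. y < z}" by auto
  with True assms show ?thesis by simp
next
  case False
  then have "{y \<in> insert x S. y < z} = {y \<in> S. y < z}" by auto
  with False show ?thesis by simp
qed

text \<open>
  The exponent counts, modulo 2, the inversions of \<open>x\<close>: the letters of \<open>u\<close> above \<open>x\<close> number
  \<open>length u\<close> minus those below \<open>x\<close>.
\<close>

lemma list_sign_insert:
  assumes "distinct (u @ x # v)"
  shows "list_sign (u @ x # v)
    = (-1) ^ (length u + card {y \<in> set (u @ v). y < x}) * list_sign (u @ v)"
  using assms
proof (induction u)
  case Nil
  then show ?case by simp
next
  case (Cons z u)
  have *: "card {y \<in> set (u @ x # v). y < z} = card {y \<in> set (u @ v). y < z} + (if x < z then 1 else 0)"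
    using card_less_insert[of "set (u @ v)" x z] Cons.prems by simp
  have **: "card {y \<in> set ((z # u) @ v). y < x} = card {y \<in> set (u @ v). y < x} + (if z < x then 1 else 0)"
    using card_less_insert[of "set (u @ v)" z x] Cons.prems by simp
  have "x \<noteq> z" using Cons.prems by auto
  then have "x < z \<longleftrightarrow> \<not> z < x" by auto
  then show ?case using Cons * **
    by (auto simp del: set_append simp: power_add)
qed

text \<open>A strictly increasing relabelling preserves inversions. Hence the passage from
  \<open>{1..p}\<close> to the indices left after an omission costs no sign.\<close>

lemma list_sign_map:
  assumes "strict_mono_on (set w) f"
  shows "list_sign (map f w) = list_sign w"
  using assms
proof (induction w)
  case Nil
  then show ?case by simp
next
  case (Cons x w)
  have "{y \<in> set (map f w). y < f x} = f ` {y \<in> set w. y < x}"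
    using strict_mono_on_less[OF Cons.prems] by auto
  moreover have "inj_on f {y \<in> set w. y < x}"
    using strict_mono_on_imp_inj_on[OF Cons.prems] by (rule inj_on_subset) auto
  moreover have "strict_mono_on (set w) f"
    using Cons.prems by (auto simp: strict_mono_on_def)
  ultimately show ?case using Cons.IH by (simp add: card_image)
qed

lemma list_sign_strict_sorted:
  assumes "sorted_wrt (<) w"
  shows "list_sign w = 1"
  using assms
proof (induction w)
  case Nil
  then show ?case by simp
next
  case (Cons x w)
  then have no_less: "{y \<in> set w. y < x} = {}" by auto
  show ?case unfolding list_sign.simps no_less using Cons by simp
qed

text \<open>Removing both letters by \<open>list_sign_insert\<close> gives expressions that are
  symmetric in \<open>x\<close> and \<open>y\<close> except for one summand of the exponent,
  \<open>y < x\<close> against \<open>x < y\<close>, and exactly one of these holds.\<close>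

lemma list_sign_swap:
  assumes "distinct (u @ x # v @ y # t)"
  shows "list_sign (u @ y # v @ x # t) = - list_sign (u @ x # v @ y # t)"
proof -
  have expand: "list_sign (u @ x # v @ y # t)
      = (-1) ^ (length u + (card {z \<in> set (u @ v @ t). z < x} + (if y < x then 1 else 0)))
        * ((-1) ^ (length (u @ v) + card {z \<in> set (u @ v @ t). z < y}) * list_sign (u @ v @ t))"
    if "distinct (u @ x # v @ y # t)" for x y
    using that list_sign_insert[of u x "v @ y # t"] list_sign_insert[of "u @ v" y t]
      card_less_insert[of "set (u @ v @ t)" y x] by simp
  have "x \<noteq> y" using assms by auto
  then have "x < y \<longleftrightarrow> \<not> y < x" by auto
  moreover have "distinct (u @ y # v @ x # t)" using assms by auto
  ultimately show ?thesis using assms expand[of x y] expand[of y x]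
    by (auto simp: power_add simp del: set_append)
qed

lemma list_sign_transpose:
  assumes "distinct w" "a \<in> set w" "b \<in> set w" "a \<noteq> b"
  shows "list_sign (map (Transposition.transpose a b) w) = - list_sign w"
proof -
  have *: "map (Transposition.transpose a b) w = w" if "a \<notin> set w" "b \<notin> set w" for w
    using that by (intro map_idI) (auto simp: transpose_def)
  obtain u s where w: "w = u @ a # s" using split_list assms by fast
  \<comment> \<open>The transposition exchanges the letters \<open>a\<close> and \<open>b\<close> of
    the word; which of them comes first is not known.\<close>
  consider v t where "s = v @ b # t" | v t where "u = v @ b # t"
    using w assms by (auto dest: split_list)
  then show ?thesis
  proof cases
    case (1 v t)
    then show ?thesis using w assms list_sign_swap[of u a v b t] by (simp add: *)
  next
    case (2 v t)
    then show ?thesis using w assms list_sign_swap[of v b t a s] by (simp add: *)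
  qed
qed

text \<open>Transpositions generate the permutations of \<open>A\<close>, and each one reverses both
  \<open>sign\<close> and the inversion sign. This links the sign of words to the sign in the
  definition of \<open>cochains\<close>.\<close>

lemma list_sign_permutes:
  assumes "\<sigma> permutes A" "finite A" "w \<in> permutations_of_set A"
  shows "list_sign (map \<sigma> w) = sign \<sigma> * list_sign w"
  using assms(1,2)
proof (induction rule: permutes_induct)
  case id
  then show ?case by simp
next
  case (swap a b p)
  have "map p w \<in> permutations_of_set A"
    using assms(3) permutations_of_set_image_permutes[OF swap.hyps(4)] by auto
  then have "list_sign (map (Transposition.transpose a b) (map p w)) = - list_sign (map p w)"
    using swap.hyps by (intro list_sign_transpose) (auto dest: permutations_of_setD)
  moreover have "sign (Transposition.transpose a b \<circ> p) = - sign p"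
    using swap.hyps assms(2) permutation_permutes[of p]
    by (subst sign_compose) (auto simp: sign_swap_id permutation_swap_id)
  ultimately show ?case using swap.IH by (simp del: o_apply)
qed

section \<open>Sums over the permutations of a set\<close>

lemma sum_permutations_of_set_image:
  assumes "bij_betw f A B"
  shows "(\<Sum>w\<in>permutations_of_set B. F w) = (\<Sum>w\<in>permutations_of_set A. F (map f w))"
proof -
  have inj: "inj_on f A" and B: "B = f ` A"
    using assms by (auto simp: bij_betw_def)
  have "inj_on (map f) (permutations_of_set A)"
    using inj_on_mapI[of f "permutations_of_set A"] inj
    by (auto dest: permutations_of_setD intro: inj_on_subset)
  then show ?thesis
    unfolding B permutations_of_set_image_inj[OF inj] by (simp add: sum.reindex)
qed

lemma insert_at_permutations_of_set:
  assumes "v \<in> permutations_of_set A" "x \<notin> A"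
  shows "take k v @ x # drop k v \<in> permutations_of_set (insert x A)"
proof -
  have "set (take k v @ drop k v) = A" "distinct (take k v @ drop k v)"
    using permutations_of_setD[OF assms(1)] by simp_all
  then have "set (take k v) \<union> set (drop k v) = A" "set (take k v) \<inter> set (drop k v) = {}"
    by (simp_all only: set_append distinct_append)
  moreover have "distinct v" using permutations_of_setD[OF assms(1)] by simp
  ultimately have "set (take k v @ x # drop k v) = insert x A" "distinct (take k v @ x # drop k v)"
    using assms(2) by auto
  then show ?thesis by (rule permutations_of_setI)
qed

text \<open>A word is the same as its letter at position \<open>k\<close> together with the word
  that remains. Positions \<open>0\<close> and \<open>p\<close> give the expansions by first and by
  last letter.\<close>

lemma sum_permutations_of_set_remove_at:
  assumes "finite A" "k < card A"
  shows "(\<Sum>w\<in>permutations_of_set A. F w)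
    = (\<Sum>i\<in>A. \<Sum>v\<in>permutations_of_set (A - {i}). F (take k v @ i # drop k v))"
proof -
  have len: "length w = card A" if "w \<in> permutations_of_set A" for w
    using that by (rule length_finite_permutations_of_set)
  have len': "length v = card A - 1" if "v \<in> permutations_of_set (A - {i})" "i \<in> A" for v i
    using length_finite_permutations_of_set[OF that(1)] that assms by simp
  have "(\<Sum>w\<in>permutations_of_set A. F w)
      = (\<Sum>(i, v)\<in>(SIGMA i:A. permutations_of_set (A - {i})). F (take k v @ i # drop k v))"
  proof (intro sum.reindex_bij_witness[where
        i = "\<lambda>(i, v). take k v @ i # drop k v" and j = "\<lambda>w. (w ! k, take k w @ drop (Suc k) w)"], goal_cases)
    case (1 w)
    then show ?case using len[of w] assms by (simp add: id_take_nth_drop[symmetric] min_def)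
  next
    case (2 w)
    let ?v = "take k w @ drop (Suc k) w"
    have w: "w = take k w @ w ! k # drop (Suc k) w"
      using 2 len[of w] assms by (simp add: id_take_nth_drop)
    have D: "set w = A" "distinct w" using 2 by (auto dest: permutations_of_setD)
    then have "distinct (take k w @ w ! k # drop (Suc k) w)" "set (take k w @ w ! k # drop (Suc k) w) = A"
      using w by metis+
    then show ?case by (auto intro!: permutations_of_setI)
  next
    case (3 iv)
    then show ?case using len' assms
      by (auto simp: nth_append min_def)
  next
    case (4 iv)
    obtain i v where iv: "iv = (i, v)" by (cases iv)
    with 4 show ?case using insert_at_permutations_of_set[of v "A - {i}" i k]
      by (simp add: insert_absorb)
  next
    case (5 w)
    then show ?case using len[of w] assms by (simp add: id_take_nth_drop[symmetric] min_def)
  qed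
  then show ?thesis by (simp add: sum.Sigma assms)
qed

text \<open>Here the letter is fixed and its position varies. This is used for the letter that is
  replaced by a commutator.\<close>

lemma sum_permutations_of_set_insert:
  assumes "finite A" "x \<notin> A"
  shows "(\<Sum>w\<in>permutations_of_set (insert x A). F w)
    = (\<Sum>v\<in>permutations_of_set A. \<Sum>k\<le>card A. F (take k v @ x # drop k v))"
proof -
  have *: "length v = card A \<and> x \<notin> set v \<and> set v = A \<and> distinct v" if "v \<in> permutations_of_set A" for v
    using that assms length_finite_permutations_of_set[OF that] by (auto dest: permutations_of_setD)
  have "(\<Sum>w\<in>permutations_of_set (insert x A). F w)
      = (\<Sum>(v, k)\<in>permutations_of_set A \<times> {..card A}. F (take k v @ x # drop k v))"
  \<comment> \<open>The inverse deletes \<open>x\<close> by \<open>filter\<close> and reads off its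
    position as the length of the prefix before it.\<close>
  proof (intro sum.reindex_bij_witness[where
        i = "\<lambda>(v, k). take k v @ x # drop k v"
        and j = "\<lambda>w. (filter (\<lambda>y. y \<noteq> x) w, length (takeWhile (\<lambda>y. y \<noteq> x) w))"], goal_cases)
    case (3 vk)
    obtain v k where vk: "vk = (v, k)" by (cases vk)
    with 3 * have v: "length v = card A" "x \<notin> set v" "k \<le> length v" by auto
    then have "\<forall>y\<in>set (take k v). y \<noteq> x" by (auto dest: in_set_takeD)
    moreover have "filter (\<lambda>y. y \<noteq> x) (take k v) @ filter (\<lambda>y. y \<noteq> x) (drop k v) = v"
      unfolding filter_append[symmetric] append_take_drop_id using v by (auto intro: filter_True)
    ultimately show ?case using v vk
      by (simp add: takeWhile_append)
  next
    case (4 vk)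
    obtain v k where vk: "vk = (v, k)" by (cases vk)
    with 4 assms show ?case using insert_at_permutations_of_set[of v A x k] by simp
  next
    case (1 w)
    then have w: "x \<in> set w" "distinct w" by (auto dest: permutations_of_setD)
    then obtain u t where "w = u @ x # t" by (meson split_list)
    moreover from this w have "filter (\<lambda>y. y \<noteq> x) u = u" "filter (\<lambda>y. y \<noteq> x) t = t"
      by (auto intro!: filter_True)
    ultimately show ?case using w by (auto simp: takeWhile_append)
  next
    case (2 w)
    then have w: "x \<in> set w" "distinct w" "set w = insert x A" by (auto dest: permutations_of_setD)
    then obtain u t where ut: "w = u @ x # t" by (meson split_list)
    then have "set (u @ t) = A" "distinct (u @ t)" using w assms by auto
    moreover from this have "length u \<le> card A" by (metis distinct_card length_append le_add1)
    ultimately show ?case using ut w by (auto simp: takeWhile_append intro!: permutations_of_setI)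
  next
    case (5 w)
    then have w: "x \<in> set w" "distinct w" by (auto dest: permutations_of_setD)
    then obtain u t where "w = u @ x # t" by (meson split_list)
    moreover from this w have "filter (\<lambda>y. y \<noteq> x) u = u" "filter (\<lambda>y. y \<noteq> x) t = t"
      by (auto intro!: filter_True)
    ultimately show ?case using w by (auto simp: takeWhile_append)
  qed
  then show ?thesis by (simp add: sum.cartesian_product)
qed

section \<open>Alternating elements of the free algebra\<close>

lemma scale_single: "scale c (Poly_Mapping.single w b) = Poly_Mapping.single w (c * b)"
  by (simp add: scale_def mult_single)

lemma scale_0 [simp]: "scale 0 E = 0"
  by (simp add: scale_def)

lemma minus_one_power_mult_single:
  "(-1) ^ n * Poly_Mapping.single w (b :: 'k::field) = (Poly_Mapping.single w ((-1) ^ n * b) :: ('v, 'k) free_algebra)"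
  by (simp add: minus_one_power_iff single_uminus)

lemma single_Word_mult:
  "Poly_Mapping.single (Word u) a * Poly_Mapping.single (Word v) b = Poly_Mapping.single (Word (u @ v)) (a * b)"
  by (simp add: mult_single plus_free_word_def)

lemma prod_list_gen: "prod_list (map (\<lambda>i. gen (g i)) w) = Poly_Mapping.single (Word (map g w)) (1 :: 'k::field)"
proof (induction w)
  case Nil
  show ?case by (simp flip: zero_free_word_def)
next
  case (Cons x w)
  then show ?case by (simp add: gen_def single_Word_mult)
qed

text \<open>The standard polynomial in the letters of \<open>A\<close>, times \<open>a\<close>. The
  scalar is an argument so that \<open>alt A\<close> parametrizes a line; \<open>A\<close> is
  arbitrary because omitted variables leave gaps.\<close>

definition alt :: "'v::linorder set \<Rightarrow> 'k::field \<Rightarrow> ('v, 'k) free_algebra" where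
  "alt A a = (\<Sum>w\<in>permutations_of_set A. Poly_Mapping.single (Word w) (a * of_int (list_sign w)))"

lemma lookup_alt:
  "Poly_Mapping.lookup (alt A a) (Word w) = (if w \<in> permutations_of_set A then a * of_int (list_sign w) else 0)"
  by (simp add: alt_def lookup_sum lookup_single when_def)

lemma keys_alt: "Poly_Mapping.keys (alt A a) \<subseteq> Word ` permutations_of_set A"
proof
  fix w assume w: "w \<in> Poly_Mapping.keys (alt A a)"
  obtain u where u: "w = Word u" by (cases w)
  with w show "w \<in> Word ` permutations_of_set A"
    by (auto simp: lookup_alt in_keys_iff split: if_splits)
qed

lemma alt_add: "alt A (a + b) = alt A a + alt A b"
  by (simp add: alt_def distrib_right single_add sum.distrib)

lemma alt_0 [simp]: "alt A 0 = 0"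
  by (simp add: alt_def)

lemma alt_uminus: "alt A (- a) = - alt A a"
  by (simp add: alt_def single_uminus sum_negf)

lemma alt_diff: "alt A (a - b) = alt A a - alt A b"
  by (simp add: alt_add alt_uminus flip: add_uminus_conv_diff)

lemma alt_sum: "alt A (sum f S) = (\<Sum>s\<in>S. alt A (f s))"
  by (induction S rule: infinite_finite_induct) (auto simp: alt_add)

lemma scale_alt: "scale c (alt A a) = alt A (c * a)"
  unfolding alt_def scale_def sum_distrib_left by (simp add: mult_single mult.assoc)

text \<open>The increasing word has sign \<open>1\<close>, so its coefficient is
  \<open>a\<close>.\<close>

lemma alt_eq_0_iff:
  assumes "finite A"
  shows "alt A a = 0 \<longleftrightarrow> a = 0"
proof
  assume "alt A a = 0"
  moreover have "sorted_list_of_set A \<in> permutations_of_set A"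
    using assms by (intro permutations_of_setI) auto
  moreover have "list_sign (sorted_list_of_set A) = 1"
    by (intro list_sign_strict_sorted) simp
  ultimately show "a = 0"
    using lookup_alt[of A a "sorted_list_of_set A"] by simp
qed simp

lemma subst_alt:
  "subst f (alt A a)
    = (\<Sum>w\<in>permutations_of_set A. scale (a * of_int (list_sign w)) (prod_list (map f w)))"
proof -
  \<comment> \<open>The keys need not be all these words (there are none for \<open>a = 0\<close>);
    the added terms have coefficient zero.\<close>
  have "subst f (alt A a) = (\<Sum>w\<in>Word ` permutations_of_set A.
      scale (Poly_Mapping.lookup (alt A a) w) (prod_list (map f (letters w))))"
    unfolding subst_def using keys_alt[of A a]
    by (intro sum.mono_neutral_left) (auto simp: in_keys_iff)
  also have "\<dots> = (\<Sum>w\<in>permutations_of_set A. scale (a * of_int (list_sign w)) (prod_list (map f w)))"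
    by (subst sum.reindex) (auto simp: inj_on_def lookup_alt)
  finally show ?thesis .
qed

lemma alt_remove_at:
  assumes "finite A" "k < card A"
  shows "alt A a = (\<Sum>i\<in>A. \<Sum>v\<in>permutations_of_set (A - {i}).
    Poly_Mapping.single (Word (take k v @ i # drop k v)) (a * of_int (list_sign (take k v @ i # drop k v))))"
  unfolding alt_def by (rule sum_permutations_of_set_remove_at[OF assms])

text \<open>After \<open>i\<close> is removed at position \<open>k\<close>, its right neighbour
  \<open>j\<close> stands at \<open>k\<close>, so the removal is repeated at the same position. The
  adjacent pair will come from a commutator.\<close>

lemma alt_remove_two_at:
  assumes "finite A" "Suc k < card A"
  shows "alt A a = (\<Sum>i\<in>A. \<Sum>j\<in>A - {i}. \<Sum>v\<in>permutations_of_set (A - {i, j}).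
    Poly_Mapping.single (Word (take k v @ i # j # drop k v)) (a * of_int (list_sign (take k v @ i # j # drop k v))))"
proof -
  have len: "length v = card A - 2" if "v \<in> permutations_of_set (A - {i} - {j})" "i \<in> A" "j \<in> A - {i}" for i j v
    using length_finite_permutations_of_set[OF that(1)] that assms by simp
  have "(\<Sum>v\<in>permutations_of_set (A - {i}).
        Poly_Mapping.single (Word (take k v @ i # drop k v)) (a * of_int (list_sign (take k v @ i # drop k v))))
      = (\<Sum>j\<in>A - {i}. \<Sum>v\<in>permutations_of_set (A - {i, j}).
        Poly_Mapping.single (Word (take k v @ i # j # drop k v)) (a * of_int (list_sign (take k v @ i # j # drop k v))))"
    if "i \<in> A" for i
  proof -
    have "finite (A - {i})" "k < card (A - {i})" using assms that by simp_all
    moreover have "take k (take k v @ j # drop k v) = take k v" "drop k (take k v @ j # drop k v) = j # drop k v"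
      if "v \<in> permutations_of_set (A - {i} - {j})" "j \<in> A - {i}" for v j
      using len[OF that(1) \<open>i \<in> A\<close> that(2)] assms by simp_all
    ultimately show ?thesis
      unfolding Diff_insert2[of A i "{_}"]
      by (subst sum_permutations_of_set_remove_at) (auto intro!: sum.cong)
  qed
  then show ?thesis
    using assms by (simp add: alt_remove_at[of A k])
qed

text \<open>\<open>f\<close> is prescribed only on \<open>A\<close>, since list lookup in
  \<open>eval_at\<close> has no meaning at other indices.\<close>

lemma subst_alt_relabel:
  assumes "bij_betw g A B" "strict_mono_on A g" "\<And>i. i \<in> A \<Longrightarrow> f i = gen (g i)"
  shows "subst f (alt A a) = alt B a"
proof -
  have *: "list_sign (map g w) = list_sign w" "map f w = map (\<lambda>i. gen (g i)) w"
    if "w \<in> permutations_of_set A" for w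
    using permutations_of_setD[OF that] assms(2,3) by (auto intro: list_sign_map)
  show ?thesis
    unfolding subst_alt unfolding alt_def sum_permutations_of_set_image[OF assms(1)]
    by (intro sum.cong refl) (simp only: * prod_list_gen scale_single mult_1_right)
qed

lemma subst_alt_permutes:
  assumes "\<sigma> permutes A" "finite A"
  shows "subst (\<lambda>i. gen (\<sigma> i)) (alt A a) = of_int (sign \<sigma>) * alt A a"
proof -
  have eq: "of_int (sign \<sigma>) * alt A a = alt A (of_int (sign \<sigma>) * a)"
    by (cases \<sigma> rule: sign_cases) (auto simp: alt_uminus)
  \<comment> \<open>A sign is its own inverse, so the factor from \<open>list_sign_permutes\<close>
    can change sides.\<close>
  have "of_int (sign \<sigma>) * of_int (sign \<sigma>) = (1 :: 'b)"
    by (simp flip: of_int_mult)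
  then have *: "of_int (sign \<sigma>) * (a * of_int (list_sign (map \<sigma> w))) = a * of_int (list_sign w)"
    if "w \<in> permutations_of_set A" for w
    using list_sign_permutes[OF assms that] by (simp add: mult.assoc[symmetric] mult.commute[of a])
  have "alt A (of_int (sign \<sigma>) * a)
      = (\<Sum>w\<in>permutations_of_set A.
          Poly_Mapping.single (Word (map \<sigma> w)) (of_int (sign \<sigma>) * (a * of_int (list_sign (map \<sigma> w)))))"
    unfolding alt_def
    by (subst sum_permutations_of_set_image[OF permutes_imp_bij[OF assms(1)]]) (simp add: mult.assoc)
  also have "\<dots> = subst (\<lambda>i. gen (\<sigma> i)) (alt A a)"
    unfolding subst_alt by (intro sum.cong refl) (simp only: * prod_list_gen scale_single mult_1_right)
  finally show ?thesis using eq by simp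
qed

section \<open>Evaluation of alternating elements\<close>

text \<open>The offset \<open>m\<close> is \<open>1\<close> when all arguments are variables, and
  \<open>2\<close> when the first argument is a commutator.\<close>

lemma nth_bij_strict_mono:
  assumes "sorted_wrt (<) (xs :: nat list)"
  shows "bij_betw (\<lambda>i. xs ! (i - m)) {m..<m + length xs} (set xs)"
    "strict_mono_on {m..<m + length xs} (\<lambda>i. xs ! (i - m))"
proof -
  show *: "strict_mono_on {m..<m + length xs} (\<lambda>i. xs ! (i - m))"
    using assms by (auto simp: strict_mono_on_def sorted_wrt_iff_nth_less)
  have "(\<lambda>i. xs ! (i - m)) ` {m..<m + length xs} = (!) xs ` (\<lambda>i. i - m) ` {m..<m + length xs}"
    by (simp add: image_image)
  also have "(\<lambda>i. i - m) ` {m..<m + length xs} = {..<length xs}"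
    by (auto intro!: image_eqI[of _ _ "_ + m"])
  also have "(!) xs ` {..<length xs} = set xs"
    by (auto simp: set_conv_nth)
  finally show "bij_betw (\<lambda>i. xs ! (i - m)) {m..<m + length xs} (set xs)"
    using strict_mono_on_imp_inj_on[OF *] by (simp add: bij_betw_def)
qed

lemma eval_at_alt_gens:
  assumes "sorted_wrt (<) xs" "length xs = p"
  shows "eval_at (alt {1..p} a) (map gen xs) = alt (set xs) a"
proof -
  have "{1..p} = {1..<1 + length xs}" using assms by auto
  then show ?thesis
    using nth_bij_strict_mono[OF assms(1), of 1] assms(2) unfolding eval_at_def
    by (intro subst_alt_relabel[where g = "\<lambda>i. xs ! (i - 1)"]) auto
qed

text \<open>Words are sorted by the position \<open>k\<close> of the letter \<open>1\<close>, which
  becomes \<open>c\<close>. As the smallest letter it contributes \<open>(-1) ^ k\<close>; the other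
  letters are relabelled increasingly by \<open>xs\<close>.\<close>

lemma eval_at_alt_Cons:
  assumes "sorted_wrt (<) xs" "length xs = q"
  shows "eval_at (alt {1..Suc q} a) (c # map gen xs)
    = (\<Sum>v\<in>permutations_of_set (set xs). \<Sum>k\<le>q. scale ((-1) ^ k * (a * of_int (list_sign v)))
        (Poly_Mapping.single (Word (take k v)) 1 * c * Poly_Mapping.single (Word (drop k v)) 1))"
proof -
  let ?f = "\<lambda>i. (c # map gen xs) ! (i - 1)" and ?g = "\<lambda>i. xs ! (i - 2)"
  let ?A = "{2..<2 + length xs}"
  have A: "{1..Suc q} = insert 1 ?A" "1 \<notin> ?A" "card ?A = q" using assms(2) by auto
  have f: "?f i = gen (?g i)" if "i \<in> ?A" for i
    using that by (auto simp: nth_Cons' numeral_2_eq_2)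
  have "eval_at (alt {1..Suc q} a) (c # map gen xs)
      = (\<Sum>v\<in>permutations_of_set ?A. \<Sum>k\<le>q.
          scale (a * of_int (list_sign (take k v @ 1 # drop k v))) (prod_list (map ?f (take k v @ 1 # drop k v))))"
    unfolding eval_at_def subst_alt A(1) using A by (subst sum_permutations_of_set_insert) auto
  also have "\<dots> = (\<Sum>v\<in>permutations_of_set ?A. \<Sum>k\<le>q. scale ((-1) ^ k * (a * of_int (list_sign (map ?g v))))
        (Poly_Mapping.single (Word (take k (map ?g v))) 1 * c * Poly_Mapping.single (Word (drop k (map ?g v))) 1))"
  proof (intro sum.cong refl)
    fix v k assume vk: "v \<in> permutations_of_set ?A" "k \<in> {..q}"
    have v: "set v = ?A" "distinct v" "length v = q"
      using permutations_of_setD[OF vk(1)] length_finite_permutations_of_set[OF vk(1)] A by auto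
    have "take k v @ 1 # drop k v \<in> permutations_of_set (insert 1 ?A)"
      by (intro insert_at_permutations_of_set vk A)
    then have "list_sign (take k v @ 1 # drop k v)
        = (-1) ^ (length (take k v) + card {y \<in> set (take k v @ drop k v). y < 1}) * list_sign (take k v @ drop k v)"
      by (intro list_sign_insert) (rule permutations_of_setD)
    moreover have no_less: "{y \<in> set (take k v @ drop k v). y < 1} = {}" using v by auto
    ultimately have sign: "list_sign (take k v @ 1 # drop k v) = (-1) ^ k * list_sign v"
      using vk v unfolding no_less by simp
    have "map ?f u = map (\<lambda>i. gen (?g i)) u" if "set u \<subseteq> ?A" for u
      using f that by (intro map_cong refl) blast
    then have "prod_list (map ?f u) = Poly_Mapping.single (Word (map ?g u)) 1" if "set u \<subseteq> ?A" for u
      using that by (simp only: prod_list_gen)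
    then have prod: "prod_list (map ?f (take k v)) = Poly_Mapping.single (Word (take k (map ?g v))) 1"
        "prod_list (map ?f (drop k v)) = Poly_Mapping.single (Word (drop k (map ?g v))) 1"
      using v(1) set_take_subset[of k v] set_drop_subset[of k v] by (simp_all only: take_map drop_map)
    have "list_sign (map ?g v) = list_sign v"
      using nth_bij_strict_mono(2)[OF assms(1), of 2] v by (intro list_sign_map) simp
    moreover have "?f 1 = c" by simp
    ultimately show "scale (a * of_int (list_sign (take k v @ 1 # drop k v))) (prod_list (map ?f (take k v @ 1 # drop k v)))
      = scale ((-1) ^ k * (a * of_int (list_sign (map ?g v))))
        (Poly_Mapping.single (Word (take k (map ?g v))) 1 * c * Poly_Mapping.single (Word (drop k (map ?g v))) 1)"
      unfolding sign map_append list.map prod_list.append prod_list.Cons prod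
      by (simp only: of_int_mult of_int_power of_int_minus of_int_1 mult.assoc mult.left_commute)
  qed
  also have "\<dots> = (\<Sum>v\<in>permutations_of_set (set xs). \<Sum>k\<le>q. scale ((-1) ^ k * (a * of_int (list_sign v)))
        (Poly_Mapping.single (Word (take k v)) 1 * c * Poly_Mapping.single (Word (drop k v)) 1))"
    by (rule sum_permutations_of_set_image[OF nth_bij_strict_mono(1)[OF assms(1)], symmetric])
  finally show ?thesis .
qed

section \<open>The differential\<close>

lemma vars_without_sorted: "sorted_wrt (<) (filter (\<lambda>m. m \<notin> S) [1..<Suc n])"
  by (intro sorted_wrt_filter sorted_wrt_upt)

lemma set_vars_without: "set (filter (\<lambda>m. m \<notin> S) [1..<Suc n]) = {1..n} - S"
  by auto

lemma length_vars_without: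
  "S \<subseteq> {1..n} \<Longrightarrow> length (filter (\<lambda>m. m \<notin> S) [1..<Suc n]) = n - card S"
  using distinct_card[of "filter (\<lambda>m. m \<notin> S) [1..<Suc n]"]
  by (simp only: set_vars_without distinct_filter distinct_upt) (simp add: card_Diff_subset finite_subset)

text \<open>All \<open>i - 1\<close> smaller indices occur in \<open>v\<close>, so the exponent is
  \<open>k + (i - 1)\<close>; it is written without subtraction to match the signs in
  \<open>diff\<close>.\<close>

lemma list_sign_insert_at:
  assumes "v \<in> permutations_of_set ({1..n} - {i})" "i \<in> {1..n}" "k < n"
  shows "list_sign (take k v @ i # drop k v) = (-1) ^ (k + i + 1) * list_sign v"
proof -
  have "take k v @ i # drop k v \<in> permutations_of_set (insert i ({1..n} - {i}))"
    using assms by (intro insert_at_permutations_of_set) auto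
  then have "list_sign (take k v @ i # drop k v)
      = (-1) ^ (length (take k v) + card {y \<in> set (take k v @ drop k v). y < i}) * list_sign (take k v @ drop k v)"
    by (intro list_sign_insert) (rule permutations_of_setD)
  moreover have "{y \<in> set (take k v @ drop k v). y < i} = {1..<i}"
    unfolding append_take_drop_id permutations_of_setD(1)[OF assms(1)] using assms(2) by auto
  moreover have "length (take k v) = k"
    using length_finite_permutations_of_set[OF assms(1)] assms by simp
  ultimately have "list_sign (take k v @ i # drop k v) = (-1) ^ (k + (i - 1)) * list_sign v"
    by simp
  moreover have "even (k + (i - 1)) \<longleftrightarrow> even (k + i + 1)" using assms(2) by (cases i) auto
  ultimately show ?thesis by (simp add: minus_one_power_iff)
qed

text \<open>First \<open>j\<close> is inserted, then \<open>i\<close>, both at \<open>k\<close>, so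
  \<open>k\<close> cancels. When \<open>j\<close> enters, \<open>i\<close> is still missing: one
  smaller letter fewer is counted if \<open>i < j\<close>, whence the extra sign.\<close>

lemma list_sign_insert_two_at:
  assumes "v \<in> permutations_of_set ({1..n} - {i, j})" "i \<in> {1..n}" "j \<in> {1..n} - {i}" "Suc k < n"
  shows "list_sign (take k v @ i # j # drop k v) = (-1) ^ (i + j) * (if i < j then -1 else 1) * list_sign v"
proof -
  have *: "take k v @ j # drop k v \<in> permutations_of_set (insert j ({1..n} - {i, j}))"
    using assms by (intro insert_at_permutations_of_set) auto
  then have "list_sign (take k v @ j # drop k v)
      = (-1) ^ (length (take k v) + card {y \<in> set (take k v @ drop k v). y < j}) * list_sign (take k v @ drop k v)"
    by (intro list_sign_insert) (rule permutations_of_setD)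
  moreover have "{y \<in> set (take k v @ drop k v). y < j} = {1..<j} - {i}"
    unfolding append_take_drop_id permutations_of_setD(1)[OF assms(1)] using assms(2,3) by auto
  moreover have len: "length v = n - 2"
    using length_finite_permutations_of_set[OF assms(1)] assms by (simp add: card_Diff_subset)
  then have "length (take k v) = k" using assms by simp
  ultimately have j: "list_sign (take k v @ j # drop k v) = (-1) ^ (k + card ({1..<j} - {i})) * list_sign v"
    by simp
  have "card ({1..<j} - {i}) + (if i < j then 1 else 0) = j - 1" using assms by auto
  then have j_eq: "j = card ({1..<j} - {i}) + (if i < j then 1 else 0) + 1" using assms(3) by simp
  have "insert j ({1..n} - {i, j}) = {1..n} - {i}" using assms by auto
  then have "take k v @ j # drop k v \<in> permutations_of_set ({1..n} - {i})" using * by simp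
  from list_sign_insert_at[OF this, of k] len assms
  have "list_sign (take k v @ i # j # drop k v) = (-1) ^ (k + i + 1) * list_sign (take k v @ j # drop k v)"
    by simp
  moreover have "even (k + card ({1..<j} - {i})) \<longleftrightarrow> even (k + j + 1 + (if i < j then 1 else 0))"
    by (subst (2) j_eq) simp
  ultimately show ?thesis unfolding j by (simp add: minus_one_power_iff)
qed

section \<open>The three sums of the differential\<close>

lemma eval_at_alt_vars_without:
  assumes "i \<in> {1..p + 1}"
  shows "eval_at (alt {1..p} a) (vars_without (p + 1) {i}) = alt ({1..p + 1} - {i}) a"
  unfolding vars_without_def
  using eval_at_alt_gens[OF vars_without_sorted, of "{i}" "p + 1" p a] length_vars_without[of "{i}" "p + 1"] assms
  unfolding set_vars_without by simp

text \<open>This is the expansion by the first letter. Putting \<open>i\<close> in front has sign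
  \<open>(-1) ^ (i + 1)\<close>, opposite to the sign in the sum.\<close>

lemma diff_left_part:
  "(\<Sum>i = 1..p + 1. (-1) ^ i * (gen i * eval_at (alt {1..p} a) (vars_without (p + 1) {i})))
    = alt {1..p + 1} (- a)"
proof -
  have "(-1) ^ i * (gen i * eval_at (alt {1..p} a) (vars_without (p + 1) {i}))
      = (\<Sum>v\<in>permutations_of_set ({1..p + 1} - {i}).
          Poly_Mapping.single (Word (take 0 v @ i # drop 0 v)) (- a * of_int (list_sign (take 0 v @ i # drop 0 v))))"
    if i: "i \<in> {1..p + 1}" for i
    unfolding eval_at_alt_vars_without[OF i] unfolding alt_def sum_distrib_left
  proof (intro sum.cong refl)
    fix v assume v: "v \<in> permutations_of_set ({1..p + 1} - {i})"
    show "(-1) ^ i * (gen i * Poly_Mapping.single (Word v) (a * of_int (list_sign v)))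
      = Poly_Mapping.single (Word (take 0 v @ i # drop 0 v)) (- a * of_int (list_sign (take 0 v @ i # drop 0 v)))"
      using list_sign_insert_at[OF v i, of 0]
      by (simp add: gen_def single_Word_mult minus_one_power_mult_single mult_ac)
  qed
  then show ?thesis by (simp only: alt_remove_at[of "{1..p + 1}" 0] finite_atLeastAtMost card_atLeastAtMost)
      simp
qed

text \<open>This is the expansion by the last letter. Insertion at position \<open>p\<close> has
  sign \<open>(-1) ^ (p + i + 1)\<close>, which differs from the sign in the sum by
  \<open>(-1) ^ p\<close>.\<close>

lemma diff_right_part:
  "(\<Sum>i = 1..p + 1. (-1) ^ (i + 1) * (eval_at (alt {1..p} a) (vars_without (p + 1) {i}) * gen i))
    = alt {1..p + 1} ((-1) ^ p * a)"
proof -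
  have "(-1) ^ (i + 1) * (eval_at (alt {1..p} a) (vars_without (p + 1) {i}) * gen i)
      = (\<Sum>v\<in>permutations_of_set ({1..p + 1} - {i}).
          Poly_Mapping.single (Word (take p v @ i # drop p v)) ((-1) ^ p * a * of_int (list_sign (take p v @ i # drop p v))))"
    if i: "i \<in> {1..p + 1}" for i
    unfolding eval_at_alt_vars_without[OF i] unfolding alt_def sum_distrib_left sum_distrib_right
  proof (intro sum.cong refl)
    fix v assume v: "v \<in> permutations_of_set ({1..p + 1} - {i})"
    then have "length v = p" using length_finite_permutations_of_set[OF v] i by simp
    then show "(-1) ^ (i + 1) * (Poly_Mapping.single (Word v) (a * of_int (list_sign v)) * gen i)
      = Poly_Mapping.single (Word (take p v @ i # drop p v)) ((-1) ^ p * a * of_int (list_sign (take p v @ i # drop p v)))"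
      using list_sign_insert_at[OF v i, of p]
      unfolding gen_def single_Word_mult minus_one_power_mult_single
      by (simp add: minus_one_power_iff)
  qed
  then show ?thesis by (simp only: alt_remove_at[of "{1..p + 1}" p] finite_atLeastAtMost card_atLeastAtMost)
      simp
qed

text \<open>The off-diagonal pairs are those with \<open>i < j\<close> and their mirror images,
  which correspond to the two terms of a commutator.\<close>

lemma sum_off_diagonal:
  fixes G :: "nat \<Rightarrow> nat \<Rightarrow> 'a::comm_monoid_add"
  shows "(\<Sum>i = 1..n. \<Sum>j\<in>{1..n} - {i}. G i j) = (\<Sum>(i, j) \<in> {(i, j). 1 \<le> i \<and> i < j \<and> j \<le> n}. G i j + G j i)"
proof -
  let ?P = "{(i, j). 1 \<le> i \<and> i < j \<and> j \<le> n}"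
  have fin: "finite ?P" by (rule finite_subset[of _ "{1..n} \<times> {1..n}"]) auto
  have "(\<Sum>i = 1..n. \<Sum>j\<in>{1..n} - {i}. G i j) = (\<Sum>(i, j)\<in>(SIGMA i:{1..n}. {1..n} - {i}). G i j)"
    by (simp add: sum.Sigma)
  also have "(SIGMA i:{1..n}. {1..n} - {i}) = ?P \<union> prod.swap ` ?P" by auto
  also have "(\<Sum>(i, j)\<in>?P \<union> prod.swap ` ?P. G i j) = (\<Sum>(i, j)\<in>?P. G i j) + (\<Sum>(i, j)\<in>prod.swap ` ?P. G i j)"
    using fin by (intro sum.union_disjoint) auto
  also have "(\<Sum>(i, j)\<in>prod.swap ` ?P. G i j) = (\<Sum>(i, j)\<in>?P. G j i)"
    by (subst sum.reindex) (auto simp: case_prod_beta)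
  also have "(\<Sum>(i, j)\<in>?P. G i j) + (\<Sum>(i, j)\<in>?P. G j i) = (\<Sum>(i, j)\<in>?P. G i j + G j i)"
    by (subst sum.distrib[symmetric]) (auto intro!: sum.cong)
  finally show ?thesis .
qed

lemma diff_commutator_part:
  "(\<Sum>(i, j) \<in> {(i, j). 1 \<le> i \<and> i < j \<and> j \<le> p + 1}.
      (-1) ^ (i + j + 1) * eval_at (alt {1..p} a) (commutator (gen i) (gen j) # vars_without (p + 1) {i, j}))
    = alt {1..p + 1} ((if odd p then 1 else 0) * a)"
proof (cases p)
  case 0
  then have "{(i, j). 1 \<le> i \<and> i < j \<and> j \<le> p + 1} = {}" by auto
  then show ?thesis using 0 by (simp only:) simp
next
  case (Suc q)
  let ?A = "{1..p + 1}" and ?P = "{(i, j). 1 \<le> i \<and> i < j \<and> j \<le> p + 1}"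
  \<comment> \<open>\<open>G k i j\<close> collects the words with \<open>i\<close> and
    \<open>j\<close> at positions \<open>k\<close> and \<open>k + 1\<close>.\<close>
  define G where "G k i j = (\<Sum>v\<in>permutations_of_set (?A - {i, j}).
      Poly_Mapping.single (Word (take k v @ i # j # drop k v))
        ((-1) ^ k * a * of_int (list_sign (take k v @ i # j # drop k v))))" for k i j
  have "(-1) ^ (i + j + 1) * eval_at (alt {1..p} a) (commutator (gen i) (gen j) # vars_without (p + 1) {i, j})
      = (\<Sum>k\<le>q. G k i j + G k j i)" if ij: "(i, j) \<in> ?P" for i j
  proof -
    have ij': "i \<in> ?A" "j \<in> ?A - {i}" "j \<in> ?A" "i \<in> ?A - {j}" "i < j" using ij by auto
    have xs: "length (filter (\<lambda>m. m \<notin> {i, j}) [1..<Suc (p + 1)]) = q"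
      using length_vars_without[of "{i, j}" "p + 1"] ij' Suc by simp
    have "(-1) ^ (i + j + 1) * eval_at (alt {1..p} a) (commutator (gen i) (gen j) # vars_without (p + 1) {i, j})
        = (\<Sum>v\<in>permutations_of_set (?A - {i, j}). \<Sum>k\<le>q. (-1) ^ (i + j + 1) *
            scale ((-1) ^ k * (a * of_int (list_sign v)))
            (Poly_Mapping.single (Word (take k v)) 1 * commutator (gen i) (gen j) * Poly_Mapping.single (Word (drop k v)) 1))"
      unfolding vars_without_def Suc eval_at_alt_Cons[OF vars_without_sorted xs[unfolded Suc]] set_vars_without
        sum_distrib_left ..
    also have "\<dots> = (\<Sum>v\<in>permutations_of_set (?A - {i, j}). \<Sum>k\<le>q.
        Poly_Mapping.single (Word (take k v @ i # j # drop k v))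
          ((-1) ^ k * a * of_int (list_sign (take k v @ i # j # drop k v)))
        + Poly_Mapping.single (Word (take k v @ j # i # drop k v))
          ((-1) ^ k * a * of_int (list_sign (take k v @ j # i # drop k v))))"
    proof (intro sum.cong refl)
      fix v k assume v: "v \<in> permutations_of_set (?A - {i, j})" and k: "k \<in> {..q}"
      have k': "Suc k < p + 1" using k Suc by simp
      have v': "v \<in> permutations_of_set (?A - {j, i})" using v by (simp add: insert_commute)
      have mono: "Poly_Mapping.single (Word (take k v)) 1 * commutator (gen i) (gen j) * Poly_Mapping.single (Word (drop k v)) (1 :: 'a)
        = Poly_Mapping.single (Word (take k v @ i # j # drop k v)) 1 - Poly_Mapping.single (Word (take k v @ j # i # drop k v)) 1"
        by (simp add: commutator_def gen_def single_Word_mult algebra_simps)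
      have scale_diff: "scale c (E - F) = scale c E - scale c F" for c :: 'a and E F :: "'a ncpoly"
        by (simp add: scale_def right_diff_distrib)
      show "(-1) ^ (i + j + 1) * scale ((-1) ^ k * (a * of_int (list_sign v)))
            (Poly_Mapping.single (Word (take k v)) 1 * commutator (gen i) (gen j) * Poly_Mapping.single (Word (drop k v)) 1)
          = Poly_Mapping.single (Word (take k v @ i # j # drop k v))
          ((-1) ^ k * a * of_int (list_sign (take k v @ i # j # drop k v)))
        + Poly_Mapping.single (Word (take k v @ j # i # drop k v))
          ((-1) ^ k * a * of_int (list_sign (take k v @ j # i # drop k v)))"
        \<comment> \<open>The minus sign of the commutator matches the sign change between the two
          orders of insertion, so both terms carry the sign of their own word.\<close>
        unfolding mono scale_diff scale_single right_diff_distrib minus_one_power_mult_single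
          list_sign_insert_two_at[OF v ij'(1,2) k'] list_sign_insert_two_at[OF v' ij'(3,4) k']
        using ij'(5) by (simp add: minus_one_power_iff single_uminus)
    qed
    also have "\<dots> = (\<Sum>k\<le>q. G k i j + G k j i)"
      unfolding G_def insert_commute[of j i] sum.distrib[symmetric] by (rule sum.swap)
    finally show ?thesis .
  qed
  then have "(\<Sum>(i, j)\<in>?P. (-1) ^ (i + j + 1) * eval_at (alt {1..p} a) (commutator (gen i) (gen j) # vars_without (p + 1) {i, j}))
      = (\<Sum>(i, j)\<in>?P. \<Sum>k\<le>q. G k i j + G k j i)"
    by (intro sum.cong) auto
  \<comment> \<open>For a fixed position \<open>k\<close>, the pairs in both orders meet every word
    exactly once.\<close>
  also have "\<dots> = (\<Sum>k\<le>q. \<Sum>(i, j)\<in>?P. G k i j + G k j i)"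
    unfolding sum.swap[of _ _ "{..q}"] by (auto intro!: sum.cong)
  also have "\<dots> = (\<Sum>k\<le>q. alt ?A ((-1) ^ k * a))"
  proof (intro sum.cong refl)
    fix k assume "k \<in> {..q}"
    then have "Suc k < card ?A" using Suc by simp
    then show "(\<Sum>(i, j)\<in>?P. G k i j + G k j i) = alt ?A ((-1) ^ k * a)"
      unfolding sum_off_diagonal[symmetric] by (subst alt_remove_two_at[of _ k]) (simp_all add: G_def)
  qed
  also have "\<dots> = alt ?A ((\<Sum>k\<le>q. (-1) ^ k) * a)"
    by (simp add: alt_sum sum_distrib_right)
  \<comment> \<open>An alternating sum of \<open>q + 1 = p\<close> terms.\<close>
  also have "(\<Sum>k\<le>q. (-1) ^ k) = (if odd p then 1 else 0 :: 'a)"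
    unfolding Suc by (induction q) auto
  finally show ?thesis .
qed

text \<open>The values have period two: \<open>\<epsilon>' - \<epsilon>\<close> for even
  \<open>p\<close> and \<open>1 - \<epsilon> - \<epsilon>'\<close> for odd \<open>p\<close>.\<close>

definition diff_coeff :: "'k::field \<Rightarrow> 'k \<Rightarrow> nat \<Rightarrow> 'k" where
  "diff_coeff \<epsilon> \<epsilon>' p = (if odd p then 1 else 0) - \<epsilon> + (-1) ^ p * \<epsilon>'"

lemma diff_alt: "diff \<epsilon> \<epsilon>' p (alt {1..p} a) = alt {1..Suc p} (diff_coeff \<epsilon> \<epsilon>' p * a)"
  unfolding diff_def diff_commutator_part diff_left_part diff_right_part scale_alt diff_coeff_def
  unfolding alt_add[symmetric] by (simp add: algebra_simps)

section \<open>The cochain spaces\<close>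

text \<open>Renaming by a bijection is injective on words, so no two coefficients are
  merged.\<close>

lemma lookup_subst_bij:
  assumes "bij \<sigma>"
  shows "Poly_Mapping.lookup (subst (\<lambda>i. gen (\<sigma> i)) E) (Word (map \<sigma> w)) = Poly_Mapping.lookup E (Word w)"
proof -
  have "Word (map \<sigma> (letters u)) = Word (map \<sigma> w) \<longleftrightarrow> u = Word w" for u
    using inj_mapI[OF bij_is_inj[OF assms]] by (cases u) (auto simp: inj_eq)
  then have "Poly_Mapping.lookup (subst (\<lambda>i. gen (\<sigma> i)) E) (Word (map \<sigma> w))
      = (\<Sum>u\<in>Poly_Mapping.keys E. if u = Word w then Poly_Mapping.lookup E u else 0)"
    unfolding subst_def prod_list_gen scale_single lookup_sum lookup_single when_def by simp
  then show ?thesis by (simp add: in_keys_iff)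
qed

text \<open>This is transitivity of the symmetric group on multilinear words:
  \<open>\<sigma>\<close> sends \<open>i\<close> to the letter in place \<open>i\<close>.\<close>

lemma permutations_of_set_eq_permutes:
  assumes "w \<in> permutations_of_set {1..n}"
  obtains \<sigma> where "\<sigma> permutes {1..n}" "w = map \<sigma> [1..<Suc n]"
proof -
  define \<sigma> where "\<sigma> i = (if i \<in> {1..n} then w ! (i - 1) else i)" for i
  have w: "set w = {1..n}" "distinct w" "length w = n"
    using permutations_of_setD[OF assms] length_finite_permutations_of_set[OF assms] by auto
  have "w = map \<sigma> [1..<Suc n]"
    using w by (intro nth_equalityI) (auto simp: \<sigma>_def simp del: upt_Suc)
  moreover have "\<sigma> permutes {1..n}"
  proof (rule bij_imp_permutes)
    have "set (map \<sigma> [1..<Suc n]) = {1..n}" "distinct (map \<sigma> [1..<Suc n])"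
      using w \<open>w = map \<sigma> [1..<Suc n]\<close> by simp_all
    then show "bij_betw \<sigma> {1..n} {1..n}"
      unfolding bij_betw_def by (simp add: distinct_map atLeastLessThanSuc_atLeastAtMost del: upt_Suc)
  qed (auto simp: \<sigma>_def)
  ultimately show ?thesis by (rule that[rotated])
qed

lemma alt_in_cochains: "alt {1..p} a \<in> cochains p"
proof -
  have "set (letters w) = {1..p} \<and> distinct (letters w)" if w: "w \<in> Poly_Mapping.keys (alt {1..p} a)" for w
  proof -
    obtain u where "w = Word u" "u \<in> permutations_of_set {1..p}" using w keys_alt[of "{1..p}" a] by blast
    then show ?thesis using permutations_of_setD[of u] by simp
  qed
  then show ?thesis
    by (auto simp: cochains_def multilinear_part_def free_alg_def subst_alt_permutes
        distinct_count_atmost_1 count_mset)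
qed

text \<open>Antisymmetry determines the coefficient of every multilinear word from that of the
  increasing one, and all other words are excluded by multilinearity.\<close>

lemma cochain_eq_alt:
  assumes "E \<in> cochains p"
  shows "E = alt {1..p} (Poly_Mapping.lookup E (Word [1..<Suc p]))"
proof (rule poly_mapping_eqI)
  fix w :: "nat free_word"
  obtain u where w: "w = Word u" by (cases w)
  let ?a = "Poly_Mapping.lookup E (Word [1..<Suc p])"
  show "Poly_Mapping.lookup E w = Poly_Mapping.lookup (alt {1..p} ?a) w"
  proof (cases "u \<in> permutations_of_set {1..p}")
    case True
    then obtain \<sigma> where \<sigma>: "\<sigma> permutes {1..p}" "u = map \<sigma> [1..<Suc p]"
      by (rule permutations_of_set_eq_permutes)
    have "[1..<Suc p] \<in> permutations_of_set {1..p}" by (intro permutations_of_setI) auto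
    then have "list_sign u = sign \<sigma> * list_sign [1..<Suc p]"
      unfolding \<sigma>(2) using \<sigma>(1) by (intro list_sign_permutes) auto
    then have sign: "list_sign u = sign \<sigma>"
      by (simp only: list_sign_strict_sorted[OF sorted_wrt_upt] mult_1_right)
    have "?a = Poly_Mapping.lookup (of_int (sign \<sigma>) * E) w"
      using assms \<sigma> lookup_subst_bij[OF permutes_bij[OF \<sigma>(1)], of E "[1..<Suc p]"]
      by (simp add: cochains_def w del: upt_Suc)
    then show ?thesis using True unfolding w lookup_alt sign
      by (cases \<sigma> rule: sign_cases) simp_all
  next
    case False
    have "w \<notin> Poly_Mapping.keys E"
    proof
      assume "w \<in> Poly_Mapping.keys E"
      then have u: "set u \<subseteq> {1..p}" "\<forall>i\<in>{1..p}. count_list u i = 1"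
        using assms unfolding cochains_def multilinear_part_def free_alg_def w by fastforce+
      have "set u = {1..p}"
        using u by (metis count_list_0_iff subsetI subset_antisym zero_neq_one)
      moreover from this u have "distinct u" by (simp add: distinct_count_atmost_1 count_mset)
      ultimately show False using False by (auto intro: permutations_of_setI)
    qed
    then show ?thesis using False by (simp add: w lookup_alt in_keys_iff)
  qed
qed

lemma cochains_eq_range_alt: "cochains p = range (alt {1..p})"
  using alt_in_cochains cochain_eq_alt by blast

section \<open>Cohomology\<close>

text \<open>Multiplication by a scalar between lines is zero or injective.\<close>

lemma cocycles_eq: "cocycles \<epsilon> \<epsilon>' p = (if diff_coeff \<epsilon> \<epsilon>' p = 0 then range (alt {1..p}) else {0})"
proof -
  have "diff \<epsilon> \<epsilon>' p 0 = 0" using diff_alt[of \<epsilon> \<epsilon>' p 0] by simp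
  moreover have "0 \<in> range (alt {1..p} :: 'a \<Rightarrow> _)" by (rule range_eqI[of _ _ 0]) simp
  ultimately show ?thesis
    unfolding cocycles_def cochains_eq_range_alt by (auto simp: diff_alt alt_eq_0_iff simp del: One_nat_def)
qed

lemma coboundaries_Suc:
  "coboundaries \<epsilon> \<epsilon>' (Suc p) = (if diff_coeff \<epsilon> \<epsilon>' p = 0 then {0} else range (alt {1..Suc p}))"
proof -
  have "coboundaries \<epsilon> \<epsilon>' (Suc p) = range (\<lambda>a. alt {1..Suc p} (diff_coeff \<epsilon> \<epsilon>' p * a))"
    by (simp add: coboundaries_def cochains_eq_range_alt image_image diff_alt del: One_nat_def)
  also have "\<dots> = alt {1..Suc p} ` range (\<lambda>a. diff_coeff \<epsilon> \<epsilon>' p * a)"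
    by (simp add: image_image)
  also have "range (\<lambda>a. diff_coeff \<epsilon> \<epsilon>' p * a) = (if diff_coeff \<epsilon> \<epsilon>' p = 0 then {0} else UNIV)"
    \<comment> \<open>A nonzero coefficient makes the map onto: division gives a preimage.\<close>
    using surjI[of "\<lambda>a. diff_coeff \<epsilon> \<epsilon>' p * a" "\<lambda>a. a / diff_coeff \<epsilon> \<epsilon>' p"] by auto
  finally show ?thesis by simp
qed

lemma cohomology_zero_if_exact:
  assumes "cocycles \<epsilon> \<epsilon>' p = coboundaries \<epsilon> \<epsilon>' p"
  shows "cohomology_zero \<epsilon> \<epsilon>' p"
proof -
  let ?B = "cocycles \<epsilon> \<epsilon>' p"
  have zero: "0 \<in> ?B" using alt_0[of "{1..p}"] unfolding cocycles_eq by (metis insertI1 rangeI)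
  have "E - F \<in> ?B" if "E \<in> ?B" "F \<in> ?B" for E F
    using that unfolding cocycles_eq by (auto simp: alt_diff[symmetric] split: if_splits)
  \<comment> \<open>The relation is total on \<open>?B\<close>, which is nonempty, so there is
    exactly one class.\<close>
  then have "{(E, F). E \<in> ?B \<and> F \<in> ?B \<and> E - F \<in> ?B} = ?B \<times> ?B" by auto
  then have "cohomology \<epsilon> \<epsilon>' p = ?B // (?B \<times> ?B)"
    unfolding cohomology_def assms[symmetric] by simp
  also have "\<dots> = {?B}" using zero by (auto simp: quotient_def)
  finally show ?thesis using assms by (simp add: cohomology_zero_def)
qed

text \<open>If exactly one of the incoming and outgoing maps vanishes, kernel and image are both the
  whole line or both zero.\<close>

lemma cohomology_zero_Suc:
  assumes "(diff_coeff \<epsilon> \<epsilon>' (Suc p) = 0) \<longleftrightarrow> (diff_coeff \<epsilon> \<epsilon>' p \<noteq> 0)"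
  shows "cohomology_zero \<epsilon> \<epsilon>' (Suc p)"
  using assms by (intro cohomology_zero_if_exact) (simp add: cocycles_eq coboundaries_Suc)

lemma cohomology_zero_0:
  assumes "diff_coeff \<epsilon> \<epsilon>' 0 \<noteq> 0"
  shows "cohomology_zero \<epsilon> \<epsilon>' 0"
  using assms by (intro cohomology_zero_if_exact) (simp add: cocycles_eq coboundaries_def)

lemma cohomology_is_ground_field_0:
  assumes "diff_coeff \<epsilon> \<epsilon>' 0 = 0"
  shows "cohomology_is_ground_field \<epsilon> \<epsilon>' 0"
proof -
  \<comment> \<open>In degree \<open>0\<close> only the empty word occurs, so
    \<open>alt {1..0} a\<close> is the constant \<open>a\<close>; its class is a singleton, as no
    map enters.\<close>
  let ?\<phi> = "\<lambda>a. {alt {1..0::nat} a}"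
  have B: "coboundaries \<epsilon> \<epsilon>' 0 = {0}" by (simp add: coboundaries_def)
  have Z: "cocycles \<epsilon> \<epsilon>' 0 = range (alt {1..0})" using assms by (simp add: cocycles_eq)
  have "inj ?\<phi>"
    by (rule injI) (metis alt_diff alt_eq_0_iff finite_atLeastAtMost right_minus_eq singleton_inject)
  moreover have "range ?\<phi> = cohomology \<epsilon> \<epsilon>' 0"
    unfolding cohomology_def Z B quotient_def by (auto simp: Image_def)
  ultimately have "bij_betw ?\<phi> UNIV (cohomology \<epsilon> \<epsilon>' 0)" by (simp add: bij_betw_def)
  moreover have "?\<phi> (a + b) = class_add (?\<phi> a) (?\<phi> b)" for a b
    unfolding class_add_def alt_add by simp
  moreover have "?\<phi> (c * a) = class_scale \<epsilon> \<epsilon>' 0 c (?\<phi> a)" for c a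
    unfolding class_scale_def B by (simp add: scale_alt)
  ultimately show ?thesis unfolding cohomology_is_ground_field_def by blast
qed

theorem proposition4p1:
  shows "acyclic_complex (0 :: 'k::field_char_0) 1
    \<and> acyclic_complex (1 :: 'k) 0
    \<and> (\<forall>\<epsilon> \<in> {0, 1 :: 'k}.
         (\<forall>p. p \<noteq> 0 \<longrightarrow> cohomology_zero \<epsilon> \<epsilon> p) \<and> cohomology_is_ground_field \<epsilon> \<epsilon> 0)"
proof (intro conjI ballI allI impI)
  show "acyclic_complex (0 :: 'k) 1" unfolding acyclic_complex_def
  proof
    \<comment> \<open>The coefficient is \<open>1\<close> for even and \<open>0\<close> for odd
      degree.\<close>
    show "cohomology_zero (0 :: 'k) 1 p" for p
      by (cases p) (auto intro!: cohomology_zero_0 cohomology_zero_Suc simp: diff_coeff_def minus_one_power_iff split: if_splits)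
  qed
  show "acyclic_complex (1 :: 'k) 0" unfolding acyclic_complex_def
  proof
    \<comment> \<open>The coefficient is \<open>-1\<close> for even and \<open>0\<close> for odd
      degree.\<close>
    show "cohomology_zero (1 :: 'k) 0 p" for p
      by (cases p) (auto intro!: cohomology_zero_0 cohomology_zero_Suc simp: diff_coeff_def minus_one_power_iff split: if_splits)
  qed
next
  fix \<epsilon> :: 'k and p :: nat
  assume "\<epsilon> \<in> {0, 1}" "p \<noteq> 0"
  \<comment> \<open>The coefficient is \<open>0\<close> for even degree and
    \<open>1 - 2 * \<epsilon>\<close>, that is \<open>1\<close> or \<open>-1\<close>, for odd
    degree.\<close>
  then show "cohomology_zero \<epsilon> \<epsilon> p"
    by (cases p) (auto intro!: cohomology_zero_Suc simp: diff_coeff_def minus_one_power_iff split: if_splits)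
next
  fix \<epsilon> :: 'k
  show "cohomology_is_ground_field \<epsilon> \<epsilon> 0"
    by (rule cohomology_is_ground_field_0) (simp add: diff_coeff_def)
qed

end
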